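(* Let $p$ be a prime, $r\geq 0$, $A=\sum_{i=0}^{r}a_ip^i$, $B=\sum_{i=0}^{r}b_ip^i$ with $a_i,b_i\in\{0,\ldots,p-1\}$, and $AB=\sum_{i=0}^{2r+1}e_ip^i$ with $e_i\in\{0,\ldots,p-1\}$; set $a_i=b_i=0$ for $i>r$. Then $e_0\equiv a_0b_0\pmod p$ and for $1\leq t\leq 2r+1$, $$e_t\equiv\sum_{(\underline{l}_0,\ldots,\underline{l}_t)\in\mathbf{L}_p(t)}\ \prod_{k=0}^{t}\tau_{\underline{l}_k}(a_0,\ldots,a_k;b_0,\ldots,b_k)\pmod p.$$
   Context: Let $\mathbb{K}=\{\underline{k}=(k_1,\ldots,k_{p-1})\in\mathbb{Z}_{\geq0}^{p-1}:\sum_l k_l\leq p-1\}$ and $\underline 0=(0,\ldots,0)$. For $\underline k\neq\underline 0$ define the polynomial over $\mathbb{F}_p$ $$\pi_{\underline k}(x,y)=\frac{y(y-1)\cdots(y-\sum_{l=1}^{p-1}k_l+1)}{k_1!\cdots k_{p-1}!}\prod_{l=1}^{p-1}\left(\frac{x(x-1)\cdots(x-l+1)}{l!}\right)^{k_l},$$ and $\pi_{\underline 0}=1$. Let $K=|\mathbb{K}\setminus\{\underline0\}|$ and fix an enumeration $\underline k(1),\ldots,\underline k(K)$ of $\mathbb{K}\setminus\{\underline 0\}$. For $\underline k\in\mathbb K$ let $w(\underline k)=\sum_{j=1}^{p-1}jk_j$. For $\underline l=(l_1,\ldots,l_K)\in\mathbb{Z}_{\ge0}^K$ let $|\underline l|=\sum_j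 l_j$ and $\underline w\cdot\underline l=\sum_{j=1}^K w(\underline k(j))l_j$. Define $\mathbf{L}_p(t)$ as the set of tuples $(\underline l_0,\ldots,\underline l_t)$ with $\underline l_m\in\mathbb{Z}_{\ge0}^K$, $|\underline l_m|\leq 1+m$, and $\sum_{m=0}^t(\underline w\cdot\underline l_m)p^m=p^t$. For $0\le m$ and $\underline l\in\mathbb{Z}_{\ge0}^K$ with $|\underline l|\le 1+m$, let $\mathbf I(m,\underline l)$ be the set of tuples $(S_1,\ldots,S_K)$ of pairwise disjoint subsets of $\{0,1,\ldots,m\}$ with $|S_j|=l_j$, and define $$\tau_{\underline l}(x_0,\ldots,x_m;y_0,\ldots,y_m)=\sum_{(S_1,\ldots,S_K)\in\mathbf I(m,\underline l)}\prod_{j=1}^K\prod_{i\in S_j}\pi_{\underline k(j)}(x_i,y_{m-i}).$$ Integers are identified with their residues in $\mathbb F_p$ when evaluating these polynomials. *)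

theory Defs
  imports "Berlekamp_Zassenhaus.Finite_Field" "HOL-Number_Theory.Cong"
    "HOL-Library.FuncSet" "HOL-Library.Disjoint_Sets"
begin

text \<open>
  A tuple with index set \<open>I\<close> is an extensional function in \<open>I \<rightarrow>\<^sub>E X\<close>, so that
  distinct functions are distinct tuples.
\<close>

definition zero_index :: "nat \<Rightarrow> nat \<Rightarrow> nat" where
  "zero_index p = (\<lambda>l\<in>{1..p-1}. 0)"

definition index_set :: "nat \<Rightarrow> (nat \<Rightarrow> nat) set" where
  "index_set p = {k \<in> {1..p-1} \<rightarrow>\<^sub>E UNIV. (\<Sum>l=1..p-1. k l) \<le> p - 1}"

definition num_indices :: "nat \<Rightarrow> nat" where
  "num_indices p = card (index_set p - {zero_index p})"

definition is_enumeration :: "nat \<Rightarrow> (nat \<Rightarrow> nat \<Rightarrow> nat) \<Rightarrow> bool" where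
  "is_enumeration p \<kappa> \<longleftrightarrow>
     bij_betw \<kappa> {1..num_indices p} (index_set p - {zero_index p})"

text \<open>
  The value at \<open>(x, y)\<close> of the polynomial indexed by \<open>k\<close>. The field \<open>'a\<close> is
  meant to be the prime field of order \<open>p\<close>; the denominators are units there because every \<open>k l\<close> and
  every \<open>l\<close> involved is at most \<open>p - 1\<close>.
\<close>

definition pi_eval :: "nat \<Rightarrow> (nat \<Rightarrow> nat) \<Rightarrow> 'a::field \<Rightarrow> 'a \<Rightarrow> 'a" where
  "pi_eval p k x y =
     (if k = zero_index p then 1
      else (\<Prod>i<(\<Sum>l=1..p-1. k l). y - of_nat i) / of_nat (\<Prod>l=1..p-1. fact (k l))
           * (\<Prod>l=1..p-1. ((\<Prod>i<l. x - of_nat i) / of_nat (fact l)) ^ k l))"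

definition weight :: "nat \<Rightarrow> (nat \<Rightarrow> nat) \<Rightarrow> nat" where
  "weight p k = (\<Sum>j=1..p-1. j * k j)"

definition tuple_size :: "nat \<Rightarrow> (nat \<Rightarrow> nat) \<Rightarrow> nat" where
  "tuple_size p l = (\<Sum>j=1..num_indices p. l j)"

definition weight_dot :: "nat \<Rightarrow> (nat \<Rightarrow> nat \<Rightarrow> nat) \<Rightarrow> (nat \<Rightarrow> nat) \<Rightarrow> nat" where
  "weight_dot p \<kappa> l = (\<Sum>j=1..num_indices p. weight p (\<kappa> j) * l j)"

definition L_set :: "nat \<Rightarrow> (nat \<Rightarrow> nat \<Rightarrow> nat) \<Rightarrow> nat \<Rightarrow> (nat \<Rightarrow> nat \<Rightarrow> nat) set" where
  "L_set p \<kappa> t =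
     {L \<in> {0..t} \<rightarrow>\<^sub>E ({1..num_indices p} \<rightarrow>\<^sub>E UNIV).
        (\<forall>m\<in>{0..t}. tuple_size p (L m) \<le> 1 + m) \<and>
        (\<Sum>m=0..t. weight_dot p \<kappa> (L m) * p ^ m) = p ^ t}"

definition I_set :: "nat \<Rightarrow> nat \<Rightarrow> (nat \<Rightarrow> nat) \<Rightarrow> (nat \<Rightarrow> nat set) set" where
  "I_set p m l =
     {S \<in> {1..num_indices p} \<rightarrow>\<^sub>E Pow {0..m}.
        disjoint_family_on S {1..num_indices p} \<and>
        (\<forall>j\<in>{1..num_indices p}. card (S j) = l j)}"

text \<open>Only \<open>x 0, \<dots>, x m\<close> and \<open>y 0, \<dots>, y m\<close> enter.\<close>

definition tau :: "nat \<Rightarrow> (nat \<Rightarrow> nat \<Rightarrow> nat) \<Rightarrow> nat \<Rightarrow> (nat \<Rightarrow> nat)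
    \<Rightarrow> (nat \<Rightarrow> 'a::field) \<Rightarrow> (nat \<Rightarrow> 'a) \<Rightarrow> 'a" where
  "tau p \<kappa> m l x y =
     (\<Sum>S\<in>I_set p m l. \<Prod>j=1..num_indices p. \<Prod>i\<in>S j. pi_eval p (\<kappa> j) (x i) (y (m - i)))"

end

theory Submission
  imports Defs
begin

text \<open>
  Modulo \<open>p\<close>, the coefficient of \<open>X ^ (p ^ t)\<close> in \<open>(1 + X) ^ N\<close> is \<open>N div p ^ t\<close>, which
  depends only on \<open>N\<close> modulo \<open>p ^ (t + 1)\<close>; so \<open>A * B\<close> may be replaced by its carry-free
  convolution truncated after \<open>p ^ t\<close>. By the Frobenius identity, \<open>1 + X\<close> raised to this convolution is
  the product over \<open>i \<le> m \<le> t\<close> of \<open>((1 + X ^ (p ^ m)) ^ a i) ^ b (m - i)\<close>. The binomial and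
  multinomial theorems expand each factor into the terms \<open>pi_eval\<close>; multiplying out over \<open>i\<close> gives
  \<open>tau\<close>, and multiplying out over \<open>m\<close> gives the sum over \<open>L_set\<close>.
\<close>

section \<open>Powers of \<open>1 + X\<close> in characteristic p\<close>

lemma linear_power_char_power:
  assumes "prime CHAR('a::comm_ring_1)"
  shows "[:1, 1:] ^ (CHAR('a) ^ t) = (1 :: 'a poly) + monom 1 (CHAR('a) ^ t)"
proof -
  have "[:1, 1:] = (1 :: 'a poly) + monom 1 1"
    by (simp add: monom_altdef one_pCons)
  thus ?thesis using assms
    by (simp add: freshmans_dream'[where m = "CHAR('a) ^ t" and n = t] monom_power)
qed

text \<open>A case of Lucas's congruence. Split the exponent as
  \<open>N mod P + (N div P) * P\<close> with \<open>P = CHAR('a) ^ t\<close>: the first part gives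
  a polynomial of degree below \<open>P\<close> with constant term 1, the second a power of
  \<open>1 + X ^ P\<close>.\<close>

lemma coeff_linear_power_char_power:
  assumes "prime CHAR('a::comm_ring_1)"
  shows "coeff ([:1, 1:] ^ N :: 'a poly) (CHAR('a) ^ t) = of_nat (N div CHAR('a) ^ t)"
proof -
  let ?P = "CHAR('a) ^ t"
  have P: "?P > 0" using assms by (simp add: prime_gt_0_nat)
  define q :: "'a poly" where "q = [:1, 1:] ^ (N mod ?P)"
  have "degree q \<le> N mod ?P"
    unfolding q_def by (rule order_trans[OF degree_power_le]) simp
  hence q0: "coeff q ?P = 0"
    by (intro coeff_eq_0) (use P in \<open>auto intro: le_less_trans\<close>)
  have q1: "coeff q 0 = 1"
    by (simp add: q_def coeff_0_power)
  note frob = linear_power_char_power[OF assms, of t]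
  \<comment> \<open>The constant coefficient is carried along because multiplication by
    \<open>monom 1 ?P\<close> moves it to position \<open>?P\<close>, where it adds 1 for each
    further factor.\<close>
  have "coeff (q * (1 + monom 1 ?P) ^ M) 0 = 1 \<and>
        coeff (q * (1 + monom 1 ?P) ^ M) ?P = of_nat M" for M
  proof (induction M)
    case 0
    then show ?case by (simp add: q0 q1)
  next
    case (Suc M)
    have "q * (1 + monom 1 ?P) ^ Suc M =
        q * (1 + monom 1 ?P) ^ M + monom 1 ?P * (q * (1 + monom 1 ?P) ^ M)"
      by (simp add: algebra_simps)
    with Suc show ?case using assms by (simp add: coeff_monom_mult)
  qed
  moreover have "[:1, 1:] ^ N = q * (1 + monom 1 ?P) ^ (N div ?P)"
    unfolding q_def frob[symmetric] power_mult[symmetric] power_add[symmetric] by simp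
  ultimately show ?thesis by simp
qed

section \<open>Falling factorials and the multinomial expansion\<close>

lemma prod_diff_of_nat_eq:
  "(\<Prod>i<s. of_nat b - of_nat i) = (of_nat (fact s * (b choose s)) :: 'a::comm_ring_1)"
proof (induction s)
  case (Suc s)
  \<comment> \<open>The recurrence for falling factorials, with the subtracted term moved to the
    left so that no truncated subtraction of naturals occurs.\<close>
  have "fact (Suc s) * (b choose Suc s) + s * (fact s * (b choose s)) = b * (fact s * (b choose s))"
  proof -
    have "Suc s * (b choose Suc s) = (b - s) * (b choose s)"
      by (simp only: binomial_absorption binomial_absorb_comp)
    hence "Suc s * (b choose Suc s) + s * (b choose s) = (b - s + s) * (b choose s)"
      by (simp only: add_mult_distrib)
    \<comment> \<open>For \<open>s > b\<close> the number \<open>b - s + s\<close> is not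
      \<open>b\<close>, but then the binomial coefficient vanishes.\<close>
    also have "\<dots> = b * (b choose s)"
      by (cases "s \<le> b") (auto simp: binomial_eq_0)
    finally have "fact s * (Suc s * (b choose Suc s) + s * (b choose s)) = fact s * (b * (b choose s))"
      by (rule arg_cong)
    thus ?thesis by (simp add: algebra_simps)
  qed
  hence "of_nat (fact (Suc s) * (b choose Suc s)) + of_nat s * of_nat (fact s * (b choose s))
     = (of_nat b * of_nat (fact s * (b choose s)) :: 'a)"
    by (metis of_nat_add of_nat_mult)
  with Suc show ?case by (simp add: algebra_simps del: of_nat_mult fact_Suc)
qed simp

lemma of_nat_fact_nonzero:
  assumes "prime CHAR('a)" "n < CHAR('a)"
  shows "of_nat (fact n) \<noteq> (0 :: 'a::semiring_1)"
  using assms by (simp add: of_nat_eq_0_iff_char_dvd prime_dvd_fact_iff del: of_nat_fact)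

text \<open>Index split for inductions on \<open>I\<close>: spending \<open>j\<close> at the new
  index leaves the budget \<open>n - j\<close> for the others.\<close>

lemma PiE_insert_sum_le_eq:
  fixes n :: nat
  assumes "finite I" "x \<notin> I"
  shows "{k \<in> insert x I \<rightarrow>\<^sub>E UNIV. sum k (insert x I) \<le> n} =
    (\<lambda>(j, k). k(x := j)) ` (SIGMA j:{..n}. {k \<in> I \<rightarrow>\<^sub>E UNIV. sum k I \<le> n - j})" (is "?A = ?f ` ?B")
proof (intro equalityI subsetI)
  fix k assume k: "k \<in> ?A"
  have "k = ?f (k x, k(x := undefined))" by simp
  moreover have "sum (k(x := undefined)) I = sum k I"
    using assms by (intro sum.cong) auto
  hence "(k x, k(x := undefined)) \<in> ?B"
    using k assms by (auto simp: PiE_def extensional_def)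
  ultimately show "k \<in> ?f ` ?B" by blast
next
  fix k assume "k \<in> ?f ` ?B"
  then obtain j k' where k: "k = k'(x := j)" "j \<le> n" "k' \<in> I \<rightarrow>\<^sub>E UNIV" "sum k' I \<le> n - j"
    by auto
  have "sum k I = sum k' I" using assms k by (intro sum.cong) auto
  thus "k \<in> ?A" using k assms by (auto simp: PiE_def extensional_def)
qed

lemma finite_PiE_sum_le: "finite I \<Longrightarrow> finite {k \<in> I \<rightarrow>\<^sub>E UNIV. sum k I \<le> (n::nat)}"
proof (induction I arbitrary: n rule: finite_induct)
  case (insert x I)
  then show ?case by (subst PiE_insert_sum_le_eq) auto
qed auto

text \<open>Induction on \<open>I\<close>: the binomial theorem separates \<open>c x\<close>, and
  the rest is expanded with exponent \<open>b - j\<close> and bound \<open>n - j\<close>. Keeping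
  \<open>n\<close> apart from \<open>b\<close> gives one index set for all exponents
  \<open>b \<le> n\<close>; terms with \<open>sum k I > b\<close> vanish, since their falling
  factorial has a zero factor. The bound \<open>n < CHAR('a)\<close> makes the factorials
  invertible.\<close>

lemma multinomial_smult:
  fixes c :: "'i \<Rightarrow> 'a::field poly"
  assumes "prime CHAR('a)" "finite I" "b \<le> n" "n < CHAR('a)"
  shows "(1 + (\<Sum>i\<in>I. c i)) ^ b =
    (\<Sum>k\<in>{k \<in> I \<rightarrow>\<^sub>E UNIV. sum k I \<le> n}.
       smult ((\<Prod>i<sum k I. of_nat b - of_nat i) / of_nat (\<Prod>i\<in>I. fact (k i)))
         (\<Prod>i\<in>I. c i ^ k i))"
  using assms(2-4)
proof (induction I arbitrary: b n rule: finite_induct)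
  case empty
  have "{k::'i \<Rightarrow> nat. k = (\<lambda>x. undefined)} = {\<lambda>x. undefined}" by auto
  then show ?case by simp
next
  case (insert x I)
  define T where "T n = {k \<in> I \<rightarrow>\<^sub>E UNIV. sum k I \<le> n}" for n :: nat
  define F where "F b s = (\<Prod>i<s. of_nat b - of_nat i :: 'a)" for b s :: nat
  define D where "D k = (of_nat (\<Prod>i\<in>I. fact (k i)) :: 'a)" for k :: "'i \<Rightarrow> nat"
  define C where "C k = (\<Prod>i\<in>I. c i ^ k i)" for k
  define G where "G k = smult ((\<Prod>i<sum k (insert x I). of_nat b - of_nat i)
      / of_nat (\<Prod>i\<in>insert x I. fact (k i))) (\<Prod>i\<in>insert x I. c i ^ k i)" for k
  have IH: "(1 + (\<Sum>i\<in>I. c i)) ^ b' = (\<Sum>k\<in>T n'. smult (F b' (sum k I) / D k) (C k))"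
    if "b' \<le> n'" "n' < CHAR('a)" for b' n'
    using insert.IH[OF that] unfolding T_def F_def D_def C_def .
  have "(1 + (\<Sum>i\<in>insert x I. c i)) ^ b = (c x + (1 + (\<Sum>i\<in>I. c i))) ^ b"
    using insert by (simp add: algebra_simps)
  also have "\<dots> = (\<Sum>j\<le>b. of_nat (b choose j) * c x ^ j * (1 + (\<Sum>i\<in>I. c i)) ^ (b - j))"
    by (rule binomial_ring)
  also have "\<dots> = (\<Sum>j\<le>n. of_nat (b choose j) * c x ^ j * (1 + (\<Sum>i\<in>I. c i)) ^ (b - j))"
    by (rule sum.mono_neutral_left) (use insert.prems in \<open>auto simp: not_le binomial_eq_0\<close>)
  also have "\<dots> = (\<Sum>j\<le>n. \<Sum>k\<in>T (n - j). G (k(x := j)))"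
  proof (rule sum.cong[OF refl])
    fix j assume j: "j \<in> {..n}"
    have fj: "(of_nat (fact j) :: 'a) \<noteq> 0"
      by (rule of_nat_fact_nonzero) (use assms insert j in auto)
    \<comment> \<open>A falling factorial of length \<open>j + s\<close> splits into its first
      \<open>j\<close> factors and the remaining \<open>s\<close>. If \<open>j + s > b\<close>, both
      sides are 0: either \<open>j > b\<close>, or \<open>s > b - j\<close>.\<close>
    have fm: "F b (j + s) = of_nat (fact j) * of_nat (b choose j) * F (b - j) s" for s
    proof (cases "j + s \<le> b")
      case True
      have "(b choose (j + s)) * ((j + s) choose j) = (b choose j) * ((b - j) choose s)"
        using choose_mult[of j "j + s" b] True by simp
      hence "fact j * fact s * ((j + s) choose j) * (b choose (j + s))
          = fact j * fact s * ((b choose j) * ((b - j) choose s))"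
        by (metis mult.assoc mult.commute)
      moreover have "fact j * fact s * ((j + s) choose j) = (fact (j + s) :: nat)"
        using binomial_fact_lemma[of j "j + s"] by simp
      ultimately have "fact (j + s) * (b choose (j + s))
          = fact j * (b choose j) * (fact s * ((b - j) choose s))"
        by (metis mult.assoc mult.left_commute)
      thus ?thesis unfolding F_def prod_diff_of_nat_eq by (metis of_nat_mult)
    next
      case False
      hence "b choose (j + s) = 0" "b choose j = 0 \<or> (b - j) choose s = 0" by auto
      thus ?thesis unfolding F_def prod_diff_of_nat_eq by (auto simp: binomial_eq_0)
    qed
    have term_eq: "of_nat (b choose j) * c x ^ j * smult (F (b - j) (sum k I) / D k) (C k) = G (k(x := j))"
      for k
    proof -
      have "sum (k(x := j)) (insert x I) = j + sum k I"
        using insert by (simp, intro sum.cong) auto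
      moreover have "(\<Prod>i\<in>insert x I. fact ((k(x := j)) i)) = fact j * (\<Prod>i\<in>I. fact (k i) :: nat)"
        using insert by (simp, intro prod.cong) auto
      moreover have "(\<Prod>i\<in>insert x I. c i ^ (k(x := j)) i) = c x ^ j * C k"
        unfolding C_def using insert by (simp, intro disjI2 prod.cong) auto
      ultimately have "G (k(x := j)) = smult (F b (j + sum k I) / (of_nat (fact j) * D k)) (c x ^ j * C k)"
        unfolding G_def F_def D_def by (simp only: of_nat_mult)
      also have "F b (j + sum k I) / (of_nat (fact j) * D k)
          = of_nat (b choose j) * (F (b - j) (sum k I) / D k)"
        unfolding fm using fj by (simp add: field_simps)
      finally show ?thesis
        by (simp add: of_nat_poly mult.commute del: fun_upd_apply)
    qed
    show "of_nat (b choose j) * c x ^ j * (1 + (\<Sum>i\<in>I. c i)) ^ (b - j)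
        = (\<Sum>k\<in>T (n - j). G (k(x := j)))"
      by (subst IH[of "b - j" "n - j"]) (use insert j term_eq in \<open>auto simp: sum_distrib_left\<close>)
  qed
  also have "\<dots> = (\<Sum>(j, k)\<in>(SIGMA j:{..n}. T (n - j)). G (k(x := j)))"
    by (rule sum.Sigma) (use insert in \<open>auto simp: T_def finite_PiE_sum_le\<close>)
  also have "\<dots> = (\<Sum>k\<in>(\<lambda>(j, k). k(x := j)) ` (SIGMA j:{..n}. T (n - j)). G k)"
  proof (subst sum.reindex)
    show "inj_on (\<lambda>(j, k). k(x := j)) (SIGMA j:{..n}. T (n - j))"
    proof (rule inj_onI, clarify)
      fix j k j' k'
      assume kk: "k \<in> T (n - j)" "k' \<in> T (n - j')" and eq: "k(x := j) = k'(x := j')"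
      have "k i = k' i" for i
        using fun_cong[OF eq, of i] kk insert by (cases "i = x") (auto simp: T_def PiE_def extensional_def)
      moreover have "j = j'" using fun_cong[OF eq, of x] by simp
      ultimately show "j = j' \<and> k = k'" by auto
    qed
  qed (simp add: case_prod_unfold)
  also have "(\<lambda>(j, k). k(x := j)) ` (SIGMA j:{..n}. T (n - j)) =
      {k \<in> insert x I \<rightarrow>\<^sub>E UNIV. sum k (insert x I) \<le> n}"
    unfolding T_def using insert by (intro PiE_insert_sum_le_eq[symmetric])
  finally show ?case unfolding G_def .
qed

text \<open>This is where \<open>pi_eval\<close> comes from. The inner power is 1 plus binomial
  terms with \<open>l\<close> from 1 to \<open>p - 1\<close>, the range being padded by zeros beyond
  \<open>a\<close>; the multinomial expansion with \<open>n = p - 1\<close> then runs over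
  \<open>index_set\<close> whatever the digits are, and \<open>weight\<close> counts the resulting
  power of \<open>X ^ q\<close>.\<close>

lemma binomial_power_eq_sum_pi_eval:
  fixes q :: nat
  assumes "prime CHAR('a)" "a < CHAR('a)" "b < CHAR('a)"
  shows "((1 + monom 1 q) ^ a) ^ b =
    (\<Sum>k\<in>index_set CHAR('a). monom (pi_eval CHAR('a) k (of_nat a) (of_nat b) :: 'a::field)
       (weight CHAR('a) k * q))"
proof -
  let ?p = "CHAR('a)"
  have fn: "(of_nat (fact l) :: 'a) \<noteq> 0" if "l < ?p" for l
    using of_nat_fact_nonzero assms(1) that by blast
  have ch: "(\<Prod>i<l. of_nat a - of_nat i) / of_nat (fact l) = (of_nat (a choose l) :: 'a)"
    if "l < ?p" for l
    using fn[OF that] by (simp add: prod_diff_of_nat_eq del: of_nat_fact)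
  have "(1 + monom 1 q) ^ a = (monom 1 q + 1 :: 'a poly) ^ a" by (simp add: add.commute)
  also have "\<dots> = (\<Sum>l\<le>a. monom (of_nat (a choose l)) (l * q))"
    by (subst binomial_ring) (simp add: monom_power of_nat_poly smult_monom mult.commute)
  also have "\<dots> = (\<Sum>l\<le>?p-1. monom (of_nat (a choose l)) (l * q))"
    by (rule sum.mono_neutral_left) (use assms in \<open>auto simp: not_le binomial_eq_0\<close>)
  also have "{..?p-1} = insert 0 {1..?p-1}" by auto
  finally have A: "(1 + monom 1 q) ^ a = 1 + (\<Sum>l=1..?p-1. monom (of_nat (a choose l) :: 'a) (l * q))"
    by simp
  show ?thesis
    unfolding A index_set_def
  proof (subst multinomial_smult[where n = "?p - 1"])
    show "(\<Sum>k\<in>{k \<in> {1..?p-1} \<rightarrow>\<^sub>E UNIV. sum k {1..?p-1} \<le> ?p-1}.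
       smult ((\<Prod>i<sum k {1..?p-1}. of_nat b - of_nat i) / of_nat (\<Prod>i=1..?p-1. fact (k i)))
        (\<Prod>i=1..?p-1. monom (of_nat (a choose i) :: 'a) (i * q) ^ k i)) =
      (\<Sum>k\<in>{k \<in> {1..?p-1} \<rightarrow>\<^sub>E UNIV. sum k {1..?p-1} \<le> ?p-1}.
       monom (pi_eval ?p k (of_nat a) (of_nat b)) (weight ?p k * q))"
    proof (rule sum.cong[OF refl])
      fix k
      have "(\<Prod>i\<in>I. monom (of_nat (a choose i) :: 'a) (i * q) ^ k i)
          = monom (\<Prod>i\<in>I. of_nat (a choose i) ^ k i) ((\<Sum>i\<in>I. i * k i) * q)" if "finite I" for I
        using that by (induction I rule: finite_induct)
          (auto simp: monom_power mult_monom algebra_simps)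
      moreover have "(\<Prod>i=1..?p-1. of_nat (a choose i) ^ k i :: 'a) =
          (\<Prod>l=1..?p-1. ((\<Prod>i<l. of_nat a - of_nat i) / of_nat (fact l)) ^ k l)"
        by (rule prod.cong[OF refl], subst ch) (use assms in auto)
      \<comment> \<open>At \<open>zero_index\<close> the general formula consists of empty products
        and zeroth powers, so it agrees with the separate value 1 in
        \<open>pi_eval_def\<close>.\<close>
      ultimately show "smult ((\<Prod>i<sum k {1..?p-1}. of_nat b - of_nat i) / of_nat (\<Prod>i=1..?p-1. fact (k i)))
        (\<Prod>i=1..?p-1. monom (of_nat (a choose i) :: 'a) (i * q) ^ k i) =
         monom (pi_eval ?p k (of_nat a) (of_nat b)) (weight ?p k * q)"
        by (auto simp: pi_eval_def weight_def smult_monom zero_index_def)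
    qed
  qed (use assms in auto)
qed

section \<open>Disjoint families of sets and the sums \<open>tau\<close>\<close>

lemma prod_one_plus_sum_eq_sum_disjoint_families:
  fixes g :: "'i \<Rightarrow> 'j \<Rightarrow> 'a::comm_semiring_1"
  assumes "finite A" "finite J"
  shows "(\<Prod>i\<in>A. 1 + (\<Sum>j\<in>J. g i j)) =
    (\<Sum>S\<in>{S \<in> J \<rightarrow>\<^sub>E Pow A. disjoint_family_on S J}. \<Prod>j\<in>J. \<Prod>i\<in>S j. g i j)"
proof -
  \<comment> \<open>Multiplying out picks one summand from each factor: \<open>None\<close> stands
    for the summand 1, \<open>Some j\<close> for \<open>g i j\<close>.\<close>
  define h where "h i o' = (case o' of None \<Rightarrow> 1 | Some j \<Rightarrow> g i j)" for i o'
  define J' where "J' = insert None (Some ` J)"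
  \<comment> \<open>A choice \<open>f\<close> is encoded by its fibres over the values
    \<open>Some j\<close>. The fibre over \<open>None\<close> is what remains of \<open>A\<close>,
    so nothing is lost.\<close>
  define \<phi> where "\<phi> f = (\<lambda>j\<in>J. {i \<in> A. f i = Some j})" for f :: "'i \<Rightarrow> 'j option"
  have "(\<Prod>i\<in>A. 1 + (\<Sum>j\<in>J. g i j)) = (\<Prod>i\<in>A. \<Sum>o'\<in>J'. h i o')"
    unfolding J'_def h_def using assms by (simp add: sum.reindex image_iff)
  also have "\<dots> = (\<Sum>f\<in>A \<rightarrow>\<^sub>E J'. \<Prod>i\<in>A. h i (f i))"
    by (rule prod_sum_PiE) (use assms in \<open>auto simp: J'_def\<close>)
  also have "\<dots> = (\<Sum>f\<in>A \<rightarrow>\<^sub>E J'. \<Prod>j\<in>J. \<Prod>i\<in>\<phi> f j. g i j)"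
  proof (rule sum.cong[OF refl])
    fix f assume f: "f \<in> A \<rightarrow>\<^sub>E J'"
    have "(\<Prod>i\<in>A. h i (f i)) = (\<Prod>o'\<in>J'. \<Prod>i\<in>{i \<in> A. f i = o'}. h i (f i))"
      by (rule prod.group[symmetric]) (use assms f in \<open>auto simp: J'_def\<close>)
    also have "\<dots> = (\<Prod>j\<in>J. \<Prod>i\<in>{i \<in> A. f i = Some j}. h i (f i))"
      unfolding J'_def using assms by (simp add: prod.reindex image_iff) (simp add: h_def)
    also have "\<dots> = (\<Prod>j\<in>J. \<Prod>i\<in>\<phi> f j. g i j)"
      by (intro prod.cong) (auto simp: \<phi>_def h_def)
    finally show "(\<Prod>i\<in>A. h i (f i)) = (\<Prod>j\<in>J. \<Prod>i\<in>\<phi> f j. g i j)" .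
  qed
  also have "\<dots> = (\<Sum>S\<in>\<phi> ` (A \<rightarrow>\<^sub>E J'). \<Prod>j\<in>J. \<Prod>i\<in>S j. g i j)"
  proof (subst sum.reindex)
    show "inj_on \<phi> (A \<rightarrow>\<^sub>E J')"
    proof (rule inj_onI)
      fix f f' assume f: "f \<in> A \<rightarrow>\<^sub>E J'" "f' \<in> A \<rightarrow>\<^sub>E J'" and eq: "\<phi> f = \<phi> f'"
      have iff: "f i = Some j \<longleftrightarrow> f' i = Some j" if "i \<in> A" "j \<in> J" for i j
        using fun_cong[OF eq, of j] that by (auto simp: \<phi>_def)
      have "f i = f' i" if i: "i \<in> A" for i
      proof -
        have "f i \<in> J'" "f' i \<in> J'" using f i by auto
        thus ?thesis using iff[OF i] unfolding J'_def by (metis imageE insertE)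
      qed
      thus "f = f'" using f by (intro PiE_ext) auto
    qed
  qed simp
  also have "\<phi> ` (A \<rightarrow>\<^sub>E J') = {S \<in> J \<rightarrow>\<^sub>E Pow A. disjoint_family_on S J}"
  proof (intro equalityI subsetI)
    fix S assume "S \<in> {S \<in> J \<rightarrow>\<^sub>E Pow A. disjoint_family_on S J}"
    hence S: "S \<in> J \<rightarrow>\<^sub>E Pow A" "disjoint_family_on S J" by auto
    \<comment> \<open>The inverse of \<open>\<phi>\<close>: disjointness leaves at most one
      \<open>j\<close> with \<open>i\<close> in \<open>S j\<close>, so the choice operator returns
      that index.\<close>
    define f where "f = (\<lambda>i\<in>A. if \<exists>j\<in>J. i \<in> S j then Some (SOME j. j \<in> J \<and> i \<in> S j) else None)"
    have some: "(SOME j. j \<in> J \<and> i \<in> S j) = j" if "j \<in> J" "i \<in> S j" for i j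
      using that S(2) by (intro some_equality) (auto simp: disjoint_family_on_def)
    have "f \<in> A \<rightarrow>\<^sub>E J'"
      unfolding f_def J'_def using some by fastforce
    moreover have "S = \<phi> f"
    proof
      fix j
      show "S j = \<phi> f j"
      proof (cases "j \<in> J")
        case True
        thus ?thesis using S(1) some by (fastforce simp: \<phi>_def f_def split: if_splits)
      next
        case False
        thus ?thesis using S(1) by (auto simp: \<phi>_def PiE_def extensional_def)
      qed
    qed
    ultimately show "S \<in> \<phi> ` (A \<rightarrow>\<^sub>E J')" by blast
  qed (auto simp: \<phi>_def disjoint_family_on_def)
  finally show ?thesis .
qed

lemma finite_index_set: "finite (index_set p)"
  unfolding index_set_def by (rule finite_PiE_sum_le) simp

lemma zero_index_in_index_set: "zero_index p \<in> index_set p"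
  by (auto simp: zero_index_def index_set_def)

text \<open>With \<open>n = 1 + m\<close> this is the range of component \<open>m\<close> in
  \<open>L_set\<close>. Named separately, it lets \<open>L_set\<close> be seen as a
  \<open>PiE\<close> product cut by one equation on exponents.\<close>

definition size_bounded_tuples :: "nat \<Rightarrow> nat \<Rightarrow> (nat \<Rightarrow> nat) set" where
  "size_bounded_tuples p n = {l \<in> {1..num_indices p} \<rightarrow>\<^sub>E UNIV. tuple_size p l \<le> n}"

lemma finite_size_bounded_tuples: "finite (size_bounded_tuples p n)"
  unfolding size_bounded_tuples_def tuple_size_def by (rule finite_PiE_sum_le) simp

lemma prod_monom: "finite A \<Longrightarrow>
  (\<Prod>i\<in>A. monom (f i) (d i)) = (monom (\<Prod>i\<in>A. f i) (\<Sum>i\<in>A. d i) :: 'a::comm_semiring_1 poly)"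
  by (induction A rule: finite_induct) (auto simp: mult_monom)

text \<open>The zero index supplies the summand 1 of each factor and \<kappa> enumerates the others,
  so the product expands over disjoint families. The exponent of a family depends only on the
  cardinalities of its members; collecting families with equal cardinalities yields
  \<open>tau\<close>.\<close>

lemma prod_sum_pi_eval_eq_sum_tau:
  fixes x y :: "nat \<Rightarrow> 'a::field"
  assumes \<kappa>: "is_enumeration p \<kappa>"
  shows "(\<Prod>i=0..m. \<Sum>k\<in>index_set p. monom (pi_eval p k (x i) (y (m - i))) (weight p k * q)) =
    (\<Sum>l\<in>size_bounded_tuples p (1 + m). monom (tau p \<kappa> m l x y) (weight_dot p \<kappa> l * q))"
proof -
  define J where "J = {1..num_indices p}"
  define g where "g i j = monom (pi_eval p (\<kappa> j) (x i) (y (m - i))) (weight p (\<kappa> j) * q)" for i j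
  define D where "D = {S \<in> J \<rightarrow>\<^sub>E Pow {0..m}. disjoint_family_on S J}"
  define cards where "cards S = (\<lambda>j\<in>J. card (S j))" for S :: "nat \<Rightarrow> nat set"
  define P where "P S = (\<Prod>j\<in>J. \<Prod>i\<in>S j. pi_eval p (\<kappa> j) (x i) (y (m - i)))" for S
  have fD: "finite D"
    unfolding D_def J_def by (rule finite_subset[OF _ finite_PiE[of J "\<lambda>_. Pow {0..m}"]]) (auto simp: J_def)
  have "(\<Sum>k\<in>index_set p. monom (pi_eval p k (x i) (y (m - i))) (weight p k * q))
      = 1 + (\<Sum>j\<in>J. g i j)" for i
  proof -
    have "weight p (zero_index p) = 0" by (simp add: weight_def zero_index_def)
    moreover have "(\<Sum>k\<in>index_set p - {zero_index p}.
        monom (pi_eval p k (x i) (y (m - i))) (weight p k * q)) = (\<Sum>j\<in>J. g i j)"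
      using sum.reindex_bij_betw[OF \<kappa>[unfolded is_enumeration_def],
        of "\<lambda>k. monom (pi_eval p k (x i) (y (m - i))) (weight p k * q)"]
      by (simp add: g_def J_def)
    ultimately show ?thesis
      by (subst sum.remove[OF finite_index_set zero_index_in_index_set]) (simp add: pi_eval_def)
  qed
  hence "(\<Prod>i=0..m. \<Sum>k\<in>index_set p. monom (pi_eval p k (x i) (y (m - i))) (weight p k * q))
      = (\<Prod>i=0..m. 1 + (\<Sum>j\<in>J. g i j))" by simp
  also have "\<dots> = (\<Sum>S\<in>D. \<Prod>j\<in>J. \<Prod>i\<in>S j. g i j)"
    unfolding D_def by (rule prod_one_plus_sum_eq_sum_disjoint_families) (auto simp: J_def)
  also have "\<dots> = (\<Sum>S\<in>D. monom (P S) (weight_dot p \<kappa> (cards S) * q))"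
  proof (rule sum.cong[OF refl])
    fix S assume "S \<in> D"
    hence fin: "finite (S j)" if "j \<in> J" for j
      using that by (auto simp: D_def PiE_iff intro: finite_subset)
    have "(\<Prod>j\<in>J. \<Prod>i\<in>S j. g i j) = (\<Prod>j\<in>J. monom (\<Prod>i\<in>S j. pi_eval p (\<kappa> j) (x i) (y (m - i)))
         (weight p (\<kappa> j) * card (S j) * q))"
      unfolding g_def by (rule prod.cong[OF refl], subst prod_monom) (auto simp: fin mult_ac)
    also have "\<dots> = monom (P S) (weight_dot p \<kappa> (cards S) * q)"
      by (subst prod_monom)
        (auto simp: P_def weight_dot_def cards_def J_def sum_distrib_right intro!: sum.cong)
    finally show "(\<Prod>j\<in>J. \<Prod>i\<in>S j. g i j) = monom (P S) (weight_dot p \<kappa> (cards S) * q)" .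
  qed
  also have "\<dots> = (\<Sum>l\<in>size_bounded_tuples p (1 + m). \<Sum>S\<in>{S \<in> D. cards S = l}.
      monom (P S) (weight_dot p \<kappa> (cards S) * q))"
  proof (rule sum.group[symmetric, OF fD finite_size_bounded_tuples], clarify)
    fix S assume S: "S \<in> D"
    \<comment> \<open>The bound \<open>1 + m\<close> arises here: disjoint subsets of
      \<open>{0..m}\<close> have at most \<open>m + 1\<close> elements in total.\<close>
    have "tuple_size p (cards S) = (\<Sum>j\<in>J. card (S j))"
      by (simp add: tuple_size_def cards_def J_def)
    also have "\<dots> = card (\<Union>j\<in>J. S j)"
      by (rule card_UN_disjoint[symmetric])
        (use S in \<open>auto simp: J_def D_def PiE_iff disjoint_family_on_def intro: finite_subset\<close>)
    also have "\<dots> \<le> card {0..m}"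
      by (rule card_mono) (use S in \<open>auto simp: D_def PiE_iff\<close>)
    finally show "cards S \<in> size_bounded_tuples p (1 + m)"
      by (simp add: size_bounded_tuples_def cards_def J_def)
  qed
  also have "\<dots> = (\<Sum>l\<in>size_bounded_tuples p (1 + m). monom (tau p \<kappa> m l x y) (weight_dot p \<kappa> l * q))"
  proof (rule sum.cong[OF refl])
    fix l assume l: "l \<in> size_bounded_tuples p (1 + m)"
    have "{S \<in> D. cards S = l} = I_set p m l"
      using l unfolding D_def I_set_def cards_def J_def size_bounded_tuples_def
      by (auto simp: PiE_def extensional_def fun_eq_iff)
    hence "tau p \<kappa> m l x y = (\<Sum>S\<in>{S \<in> D. cards S = l}. P S)"
      by (simp add: tau_def P_def J_def)
    thus "(\<Sum>S\<in>{S \<in> D. cards S = l}. monom (P S) (weight_dot p \<kappa> (cards S) * q))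
      = monom (tau p \<kappa> m l x y) (weight_dot p \<kappa> l * q)"
      by (simp add: monom_hom.hom_sum)
  qed
  finally show ?thesis .
qed

section \<open>Digits and congruences modulo powers of p\<close>

lemma cong_sum_powers_truncate:
  fixes d :: "nat \<Rightarrow> nat"
  assumes "t \<le> n"
  shows "[(\<Sum>i=0..n. d i * p ^ i) = (\<Sum>i=0..t. d i * p ^ i)] (mod p ^ Suc t)"
  using assms
proof (induction n rule: dec_induct)
  case (step n)
  have "p ^ Suc t dvd p ^ Suc n" using step by (intro le_imp_power_dvd) simp
  hence "[d (Suc n) * p ^ Suc n = 0] (mod p ^ Suc t)"
    by (simp only: cong_0_iff dvd_mult)
  from cong_add[OF step.IH this] show ?case by simp
qed simp

text \<open>\<open>M div p ^ t mod p\<close> can be read off from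
  \<open>M mod p ^ Suc t\<close>.\<close>

lemma cong_div_power:
  fixes M N :: nat
  assumes "[M = N] (mod p ^ Suc t)" "p > 0"
  shows "[M div p ^ t = N div p ^ t] (mod p)"
proof -
  have "M div p ^ t mod p = M mod (p ^ t * p) div p ^ t" for M
    using assms(2) by (simp add: mod_mult2_eq)
  thus ?thesis using assms(1) by (simp add: cong_def mult.commute)
qed

lemma sum_digits_less:
  fixes d :: "nat \<Rightarrow> nat"
  assumes "\<forall>i<t. d i < p"
  shows "(\<Sum>i<t. d i * p ^ i) < p ^ t"
  using assms
proof (induction t)
  case (Suc t)
  have "d t * p ^ t + p ^ t \<le> p * p ^ t"
    using Suc.prems by (metis add.commute lessI mult_Suc mult_le_mono1 Suc_leI)
  with Suc show ?case by force
qed simp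

lemma sum_digits_div:
  fixes d :: "nat \<Rightarrow> nat"
  assumes "\<forall>i<t. d i < p" "p > 0"
  shows "(\<Sum>i=0..t. d i * p ^ i) div p ^ t = d t"
proof -
  have "(\<Sum>i=0..t. d i * p ^ i) = (\<Sum>i<t. d i * p ^ i) + d t * p ^ t"
    by (simp add: atLeast0AtMost flip: lessThan_Suc_atMost)
  thus ?thesis using sum_digits_less[OF assms(1)] assms(2) by simp
qed

section \<open>The convolution as an exponent, and the digit formula\<close>

lemma coeff_linear_power_convolution:
  fixes a b :: "nat \<Rightarrow> nat"
  assumes p: "CHAR('a::field) = p" "prime p"
    and \<kappa>: "is_enumeration p \<kappa>"
    and digits: "\<And>i. a i < p" "\<And>i. b i < p"
  shows "coeff ([:1, 1:] ^ (\<Sum>m=0..t. (\<Sum>i=0..m. a i * b (m - i)) * p ^ m) :: 'a poly) (p ^ t) =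
    (\<Sum>L\<in>L_set p \<kappa> t. \<Prod>k=0..t. tau p \<kappa> k (L k) (\<lambda>i. of_nat (a i)) (\<lambda>i. of_nat (b i)))"
proof -
  let ?x = "\<lambda>i. of_nat (a i) :: 'a" and ?y = "\<lambda>i. of_nat (b i) :: 'a"
  let ?T = "\<lambda>m. size_bounded_tuples p (1 + m)"
  have frob: "[:1, 1:] ^ (p ^ m) = (1 :: 'a poly) + monom 1 (p ^ m)" for m
    using linear_power_char_power[where 'a = 'a, unfolded p(1), OF p(2)] .
  have "[:1, 1:] ^ (\<Sum>m=0..t. (\<Sum>i=0..m. a i * b (m - i)) * p ^ m) =
      (\<Prod>m=0..t. \<Prod>i=0..m. ((1 + monom (1 :: 'a) (p ^ m)) ^ a i) ^ b (m - i))"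
  proof -
    have "[:1, 1:] ^ ((\<Sum>i=0..m. a i * b (m - i)) * p ^ m) =
        (\<Prod>i=0..m. ((1 + monom (1 :: 'a) (p ^ m)) ^ a i) ^ b (m - i))" for m
    proof -
      have "[:1, 1:] ^ ((\<Sum>i=0..m. a i * b (m - i)) * p ^ m) =
          ([:1, 1:] ^ (p ^ m) :: 'a poly) ^ (\<Sum>i=0..m. a i * b (m - i))"
        by (subst mult.commute) (rule power_mult)
      also have "\<dots> = (1 + monom 1 (p ^ m)) ^ (\<Sum>i=0..m. a i * b (m - i))"
        by (simp only: frob)
      finally show ?thesis by (simp only: power_sum power_mult)
    qed
    thus ?thesis by (simp only: power_sum)
  qed
  also have "\<dots> = (\<Prod>m=0..t. \<Prod>i=0..m. \<Sum>k\<in>index_set p.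
      monom (pi_eval p k (?x i) (?y (m - i))) (weight p k * p ^ m))"
    using binomial_power_eq_sum_pi_eval[where 'a = 'a, unfolded p(1)] p(2) digits by simp
  also have "\<dots> = (\<Prod>m=0..t. \<Sum>l\<in>?T m. monom (tau p \<kappa> m l ?x ?y) (weight_dot p \<kappa> l * p ^ m))"
    by (rule prod.cong[OF refl], rule prod_sum_pi_eval_eq_sum_tau[OF \<kappa>])
  \<comment> \<open>Choosing one \<open>l\<close> in the factor for each \<open>m\<close> amounts to
    choosing a tuple \<open>L\<close>.\<close>
  also have "\<dots> = (\<Sum>L\<in>PiE {0..t} ?T. \<Prod>m=0..t.
      monom (tau p \<kappa> m (L m) ?x ?y) (weight_dot p \<kappa> (L m) * p ^ m))"
    by (rule prod_sum_PiE) (auto simp: finite_size_bounded_tuples)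
  also have "\<dots> = (\<Sum>L\<in>PiE {0..t} ?T. monom (\<Prod>m=0..t. tau p \<kappa> m (L m) ?x ?y)
      (\<Sum>m=0..t. weight_dot p \<kappa> (L m) * p ^ m))"
    by (simp add: prod_monom)
  finally have expand: "[:1, 1:] ^ (\<Sum>m=0..t. (\<Sum>i=0..m. a i * b (m - i)) * p ^ m) = \<dots>" .
  \<comment> \<open>Taking the coefficient at \<open>p ^ t\<close> keeps the tuples whose total
    exponent is \<open>p ^ t\<close>, which is the equation defining \<open>L_set\<close>.\<close>
  have "L_set p \<kappa> t =
      {L \<in> PiE {0..t} ?T. (\<Sum>m=0..t. weight_dot p \<kappa> (L m) * p ^ m) = p ^ t}"
    unfolding L_set_def size_bounded_tuples_def PiE_def Pi_def by blast
  moreover have "finite (PiE {0..t} ?T)"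
    by (rule finite_PiE) (auto simp: finite_size_bounded_tuples)
  ultimately show ?thesis
    unfolding expand coeff_sum coeff_monom
    by (simp add: sum.inter_filter)
qed

theorem theorem4p4:
  fixes p r A B :: nat
    and a b e :: "nat \<Rightarrow> nat"
    and \<kappa> :: "nat \<Rightarrow> nat \<Rightarrow> nat"
  assumes "prime p"
    and "CARD('p::prime_card) = p"
    and "is_enumeration p \<kappa>"
    and "A = (\<Sum>i=0..r. a i * p ^ i)"
    and "B = (\<Sum>i=0..r. b i * p ^ i)"
    and "\<forall>i\<in>{0..r}. a i \<in> {0..p-1} \<and> b i \<in> {0..p-1}"
    and "A * B = (\<Sum>i=0..2*r+1. e i * p ^ i)"
    and "\<forall>i\<in>{0..2*r+1}. e i \<in> {0..p-1}"
    and "\<forall>i>r. a i = 0 \<and> b i = 0"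
  shows "[e 0 = a 0 * b 0] (mod p) \<and>
    (\<forall>t\<in>{1..2*r+1}.
       (of_nat (e t) :: 'p mod_ring) =
         (\<Sum>L\<in>L_set p \<kappa> t. \<Prod>k=0..t.
            tau p \<kappa> k (L k) (\<lambda>i. of_nat (a i)) (\<lambda>i. of_nat (b i))))"
proof -
  define N where "N t = (\<Sum>m=0..t. (\<Sum>i=0..m. a i * b (m - i)) * p ^ m)" for t
  have p0: "p > 0" using assms(1) by (simp add: prime_gt_0_nat)
  have char: "CHAR('p mod_ring) = p" using assms(2) by simp
  have digits: "a i < p" "b i < p" for i
    using assms(6,9) p0 by (cases "i \<le> r"; force)+
  have e: "e i < p" if "i \<le> 2*r+1" for i
    using assms(8) p0 that by force
  \<comment> \<open>The zero digit \<open>b (r+1)\<close> is appended so that the convolution runs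
    up to \<open>2*r+1\<close>, the top index of the digits \<open>e\<close>.\<close>
  have "B = (\<Sum>i\<le>r+1. b i * p ^ i)"
    using assms(5,9) by (simp add: atLeast0AtMost)
  moreover have "A = (\<Sum>i\<le>r. a i * p ^ i)"
    using assms(4) by (simp add: atLeast0AtMost)
  ultimately have "A * B = (\<Sum>m\<le>r+(r+1). (\<Sum>i\<le>m. a i * b (m - i)) * p ^ m)"
    using polynomial_product_nat[of r a "r+1" b p] assms(9) by simp
  hence AB: "A * B = N (2*r+1)"
    by (simp add: N_def atLeast0AtMost mult_2)
  \<comment> \<open>Both sides are truncations of expansions of \<open>A * B\<close>. The entries of
    \<open>N\<close> may exceed \<open>p - 1\<close>, which does not matter for the
    congruence.\<close>
  have cong: "[(\<Sum>i=0..t. e i * p ^ i) = N t] (mod p ^ Suc t)" if "t \<le> 2*r+1" for t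
  proof -
    have "[A * B = (\<Sum>i=0..t. e i * p ^ i)] (mod p ^ Suc t)"
      unfolding assms(7) by (rule cong_sum_powers_truncate[OF that])
    moreover have "[A * B = N t] (mod p ^ Suc t)"
      unfolding AB N_def by (rule cong_sum_powers_truncate[OF that])
    ultimately show ?thesis by (metis cong_sym cong_trans)
  qed
  show ?thesis
  proof (intro conjI ballI)
    show "[e 0 = a 0 * b 0] (mod p)"
      using cong[of 0] by (simp add: N_def)
  next
    fix t assume t: "t \<in> {1..2*r+1}"
    \<comment> \<open>On the left the quotient is exactly \<open>e t\<close>, because the lower
      digits sum to less than \<open>p ^ t\<close>; on the right it is the coefficient of
      \<open>X ^ (p ^ t)\<close> in \<open>(1 + X) ^ N t\<close>, read modulo
      \<open>p\<close>.\<close>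
    have "[(\<Sum>i=0..t. e i * p ^ i) div p ^ t = N t div p ^ t] (mod p)"
      using t by (intro cong_div_power cong p0) auto
    moreover have "(\<Sum>i=0..t. e i * p ^ i) div p ^ t = e t"
      using t e p0 by (intro sum_digits_div) auto
    ultimately have "[e t = N t div p ^ t] (mod p)" by simp
    hence "(of_nat (e t) :: 'p mod_ring) = of_nat (N t div p ^ t)"
      using char by (simp add: of_nat_eq_iff_cong_CHAR)
    also have "\<dots> = coeff ([:1, 1:] ^ N t) (p ^ t)"
      using coeff_linear_power_char_power[where 'a = "'p mod_ring", unfolded char, OF assms(1)] by simp
    finally show "(of_nat (e t) :: 'p mod_ring) =
         (\<Sum>L\<in>L_set p \<kappa> t. \<Prod>k=0..t.
            tau p \<kappa> k (L k) (\<lambda>i. of_nat (a i)) (\<lambda>i. of_nat (b i)))"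
      unfolding N_def using coeff_linear_power_convolution[OF char assms(1,3) digits] by simp
  qed
qed

end
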